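(* Let $G$ be a $\overline{C}$-group. The torsion of $A(G)$ is $$\mathrm{Tor}(A(G))=\operatorname{Ker}(\mathrm{Ab})\cap\pi^{-1}(\mathrm{Tor}(G)),$$ which is isomorphic to a subgroup of $\mathrm{Tor}(G)$.
   Context: For a group $H$, $\mathrm{Tor}(H)$ denotes the torsion of $H$, i.e., its elements of finite order. For a group $G$, $A(G)=\langle e_a,\ a\in G \mid e_ae_b=e_b e_{b^{-1}ab},\ a,b\in G\rangle$. The set of conjugacy classes of $G$ is $\mathfrak{C}(G)$, and $\mathbb{Z}^{\mathfrak{C}(G)}$ is the free abelian group with basis $(c_{\mathcal{O}})_{\mathcal{O}\in\mathfrak{C}(G)}$ (direct sum). The homomorphism $\pi\colon A(G)\to G$ is defined by $e_a\mapsto a$, and $\mathrm{Ab}\colon A(G)\to\mathbb{Z}^{\mathfrak{C}(G)}$ (the abelianisation map) by $e_a\mapsto c_{\mathcal{O}}$, where $\mathcal{O}$ is the conjugacy class of $a$. A $\overline{C}$-group is a group $G$ admitting a presentation, with some generator set $\Gamma$, in which every relation is either a conjugation relation $b^{-1}ab=c$ with $a,b,c\in\Gamma$, or a power relation $a^k=1$ with $a\in\Gamma$, $k\ge 2$; without loss of generality, only one power relation is allowed per conjugacy class of $G$ (i.e., for each conjugacy class $\mathcal{O}$ of $G$, at most one power relation $a^k=1$ has $a\in\mathcal{O}$).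
   Formalization: Tor(A(G)) need not be a group (e.g. G the affine Weyl group of type A_2), so "isomorphic to a subgroup of Tor(G)" is proved when Tor(A(G)) is a subgroup; in general, Tor(A(G)) is isomorphic, for the partial multiplication, to H ∩ Tor(G) with H a subgroup of G. *)

theory Defs
  imports "HOL-Algebra.Free_Abelian_Groups"
begin

section \<open>Groups given by generators and relations\<close>

text \<open>A letter \<open>(x, True)\<close> stands for the generator \<open>x\<close>, and \<open>(x, False)\<close> for its inverse.
  A relation \<open>u = v\<close> is the pair \<open>(u, v)\<close> of words.\<close>

type_synonym 'g word = "('g \<times> bool) list"

definition words :: "'g set \<Rightarrow> 'g word set" where
  "words X = lists (X \<times> UNIV)"

inductive pres_eq :: "'g set \<Rightarrow> ('g word \<times> 'g word) set \<Rightarrow> 'g word \<Rightarrow> 'g word \<Rightarrow> bool"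
  for X R where
  refl: "w \<in> words X \<Longrightarrow> pres_eq X R w w"
| sym: "pres_eq X R u v \<Longrightarrow> pres_eq X R v u"
| trans: "pres_eq X R u v \<Longrightarrow> pres_eq X R v w \<Longrightarrow> pres_eq X R u w"
| cancel: "u \<in> words X \<Longrightarrow> v \<in> words X \<Longrightarrow> x \<in> X \<Longrightarrow>
    pres_eq X R (u @ [(x, b), (x, \<not> b)] @ v) (u @ v)"
| rel: "u \<in> words X \<Longrightarrow> v \<in> words X \<Longrightarrow> r \<in> words X \<Longrightarrow> s \<in> words X \<Longrightarrow> (r, s) \<in> R \<Longrightarrow>
    pres_eq X R (u @ r @ v) (u @ s @ v)"

definition pres_class :: "'g set \<Rightarrow> ('g word \<times> 'g word) set \<Rightarrow> 'g word \<Rightarrow> 'g word set" where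
  "pres_class X R w = {v. pres_eq X R w v}"

definition presented_group ::
    "'g set \<Rightarrow> ('g word \<times> 'g word) set \<Rightarrow> 'g word set monoid" where
  "presented_group X R =
     \<lparr>carrier = pres_class X R ` words X,
      monoid.mult = (\<lambda>U V. \<Union>u\<in>U. \<Union>v\<in>V. pres_class X R (u @ v)),
      one = pres_class X R []\<rparr>"

definition pres_gen :: "'g set \<Rightarrow> ('g word \<times> 'g word) set \<Rightarrow> 'g \<Rightarrow> 'g word set" where
  "pres_gen X R x = pres_class X R [(x, True)]"

fun word_eval :: "('h, 'm) monoid_scheme \<Rightarrow> ('g \<Rightarrow> 'h) \<Rightarrow> 'g word \<Rightarrow> 'h" where
  "word_eval H f [] = \<one>\<^bsub>H\<^esub>"
| "word_eval H f ((x, b) # w) =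
     (if b then f x else inv\<^bsub>H\<^esub> (f x)) \<otimes>\<^bsub>H\<^esub> word_eval H f w"

text \<open>The homomorphism out of a presented group determined by \<open>x \<mapsto> f x\<close> on the generators; it is
  meaningful when the relations hold in \<open>H\<close> (lemma \<open>pres_lift_hom\<close>), as then all words of a class
  have the same value.\<close>

definition pres_lift :: "('h, 'm) monoid_scheme \<Rightarrow> ('g \<Rightarrow> 'h) \<Rightarrow> 'g word set \<Rightarrow> 'h" where
  "pres_lift H f U = the_elem (word_eval H f ` U)"

lemma words_simps [simp]:
  "[] \<in> words X" "u @ v \<in> words X \<longleftrightarrow> u \<in> words X \<and> v \<in> words X"
  "p # w \<in> words X \<longleftrightarrow> fst p \<in> X \<and> w \<in> words X"
  by (auto simp: words_def mem_Times_iff)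

lemma pres_eq_words: "pres_eq X R u v \<Longrightarrow> u \<in> words X \<and> v \<in> words X"
  by (induction rule: pres_eq.induct) auto

lemma pres_eq_append_right: "pres_eq X R u v \<Longrightarrow> w \<in> words X \<Longrightarrow> pres_eq X R (u @ w) (v @ w)"
proof (induction rule: pres_eq.induct)
  case (cancel u v x b)
  then show ?case using pres_eq.cancel[of u X "v @ w" x R b] by simp
next
  case (rel u v r s)
  then show ?case using pres_eq.rel[of u X "v @ w" r s R] by simp
qed (simp_all add: pres_eq.refl pres_eq.sym, meson pres_eq.trans)

lemma pres_eq_append_left: "pres_eq X R u v \<Longrightarrow> w \<in> words X \<Longrightarrow> pres_eq X R (w @ u) (w @ v)"
proof (induction rule: pres_eq.induct)
  case (cancel u v x b)
  then show ?case using pres_eq.cancel[of "w @ u" X v x R b] by simp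
next
  case (rel u v r s)
  then show ?case using pres_eq.rel[of "w @ u" X v r s R] by simp
qed (simp_all add: pres_eq.refl pres_eq.sym, meson pres_eq.trans)

lemma pres_eq_append:
  "pres_eq X R u u' \<Longrightarrow> pres_eq X R v v' \<Longrightarrow> pres_eq X R (u @ v) (u' @ v')"
  by (meson pres_eq.trans pres_eq_append_left pres_eq_append_right pres_eq_words)

lemma pres_class_eq_iff:
  "u \<in> words X \<Longrightarrow> pres_class X R u = pres_class X R v \<longleftrightarrow> pres_eq X R u v"
proof
  assume "u \<in> words X" "pres_class X R u = pres_class X R v"
  then have "u \<in> pres_class X R v" using pres_eq.refl[of u X R] by (auto simp: pres_class_def)
  then show "pres_eq X R u v" by (simp add: pres_class_def pres_eq.sym)
next
  assume uv: "pres_eq X R u v"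
  show "pres_class X R u = pres_class X R v"
    unfolding pres_class_def
    using pres_eq.trans[OF uv] pres_eq.trans[OF pres_eq.sym[OF uv]] by blast
qed

lemma mult_presented_group:
  assumes "u \<in> words X" "v \<in> words X"
  shows "pres_class X R u \<otimes>\<^bsub>presented_group X R\<^esub> pres_class X R v = pres_class X R (u @ v)"
proof -
  have "pres_class X R (u' @ v') = pres_class X R (u @ v)"
    if "u' \<in> pres_class X R u" "v' \<in> pres_class X R v" for u' v'
  proof -
    have "pres_eq X R (u @ v) (u' @ v')"
      using that by (intro pres_eq_append) (simp_all add: pres_class_def)
    then show ?thesis using assms pres_class_eq_iff[of "u @ v" X R "u' @ v'"] by simp
  qed
  moreover have "u \<in> pres_class X R u" "v \<in> pres_class X R v"
    using assms by (simp_all add: pres_class_def pres_eq.refl)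
  ultimately have "(\<Union>u'\<in>pres_class X R u. \<Union>v'\<in>pres_class X R v. pres_class X R (u' @ v'))
      = pres_class X R (u @ v)"
    by blast
  then show ?thesis by (simp add: presented_group_def)
qed

lemma carrier_presented_group: "carrier (presented_group X R) = pres_class X R ` words X"
  and one_presented_group: "\<one>\<^bsub>presented_group X R\<^esub> = pres_class X R []"
  by (simp_all add: presented_group_def)

lemma pres_eq_left_inverse:
  "w \<in> words X \<Longrightarrow> \<exists>w'\<in>words X. pres_eq X R (w' @ w) []"
proof (induction w)
  case Nil
  then show ?case by (auto intro!: bexI[of _ "[]"] pres_eq.refl)
next
  case (Cons p w)
  obtain x b where p: "p = (x, b)" by force
  from Cons p obtain w' where w': "w' \<in> words X" "pres_eq X R (w' @ w) []" by auto
  have "pres_eq X R (w' @ [(x, \<not> b), (x, \<not> \<not> b)] @ w) (w' @ w)"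
    using Cons w' p by (intro pres_eq.cancel) auto
  then have "pres_eq X R ((w' @ [(x, \<not> b)]) @ p # w) []"
    using pres_eq.trans w' p by fastforce
  then show ?case using w' Cons p by (intro bexI[of _ "w' @ [(x, \<not> b)]"]) auto
qed

lemma group_presented_group: "group (presented_group X R)"
proof (rule groupI)
  fix U assume "U \<in> carrier (presented_group X R)"
  then obtain u where u: "u \<in> words X" "U = pres_class X R u"
    by (auto simp: carrier_presented_group)
  then obtain u' where u': "u' \<in> words X" "pres_eq X R (u' @ u) []"
    using pres_eq_left_inverse[of u X R] by blast
  then show "\<exists>V\<in>carrier (presented_group X R). V \<otimes>\<^bsub>presented_group X R\<^esub> U = \<one>\<^bsub>presented_group X R\<^esub>"
    using u by (intro bexI[of _ "pres_class X R u'"])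
      (auto simp: carrier_presented_group one_presented_group mult_presented_group pres_class_eq_iff)
qed (auto simp: carrier_presented_group one_presented_group mult_presented_group)

lemma (in group) word_eval_closed:
  "f ` X \<subseteq> carrier G \<Longrightarrow> w \<in> words X \<Longrightarrow> word_eval G f w \<in> carrier G"
  by (induction w) auto

lemma (in group) word_eval_append:
  "f ` X \<subseteq> carrier G \<Longrightarrow> u \<in> words X \<Longrightarrow> v \<in> words X \<Longrightarrow>
     word_eval G f (u @ v) = word_eval G f u \<otimes> word_eval G f v"
proof (induction u)
  case Nil
  then show ?case by (simp add: word_eval_closed)
next
  case (Cons p u)
  then have "word_eval G f u \<in> carrier G" "word_eval G f v \<in> carrier G"
    by (auto intro!: word_eval_closed[of f X])
  then show ?case using Cons by (cases p) (auto intro!: m_assoc[symmetric])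
qed

lemma (in group) word_eval_pres_eq:
  assumes "f ` X \<subseteq> carrier G"
    and "\<And>r s. (r, s) \<in> R \<Longrightarrow> r \<in> words X \<Longrightarrow> s \<in> words X \<Longrightarrow> word_eval G f r = word_eval G f s"
  shows "pres_eq X R u v \<Longrightarrow> word_eval G f u = word_eval G f v"
proof (induction rule: pres_eq.induct)
  case (cancel u v x b)
  have "f x \<in> carrier G" "word_eval G f v \<in> carrier G"
    using cancel assms(1) by (auto intro!: word_eval_closed[of f X])
  then have "word_eval G f ([(x, b), (x, \<not> b)] @ v) = word_eval G f v"
    by (cases b) (simp_all add: m_assoc[symmetric])
  then show ?case
    using cancel assms(1) by (simp add: word_eval_append[of f X] del: append_Cons append_Nil word_eval.simps)
next
  case (rel u v r s)
  then show ?case using assms by (simp add: word_eval_append[of f X])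
qed auto

lemma (in group) pres_lift_class:
  assumes "f ` X \<subseteq> carrier G"
    and "\<And>r s. (r, s) \<in> R \<Longrightarrow> r \<in> words X \<Longrightarrow> s \<in> words X \<Longrightarrow> word_eval G f r = word_eval G f s"
    and "w \<in> words X"
  shows "pres_lift G f (pres_class X R w) = word_eval G f w"
proof -
  have "w \<in> pres_class X R w"
    using assms by (simp add: pres_class_def pres_eq.refl)
  moreover have "word_eval G f v = word_eval G f w" if "v \<in> pres_class X R w" for v
    using that word_eval_pres_eq[of f X R w v, OF assms(1,2)] by (simp add: pres_class_def)
  ultimately have "word_eval G f ` pres_class X R w = {word_eval G f w}"
    by blast
  then show ?thesis by (simp add: pres_lift_def)
qed

lemma (in group) pres_lift_hom:
  assumes "f ` X \<subseteq> carrier G"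
    and "\<And>r s. (r, s) \<in> R \<Longrightarrow> r \<in> words X \<Longrightarrow> s \<in> words X \<Longrightarrow> word_eval G f r = word_eval G f s"
  shows "pres_lift G f \<in> hom (presented_group X R) G"
  using assms
  by (auto intro!: homI simp: carrier_presented_group mult_presented_group word_eval_closed[of f X]
      pres_lift_class[of f X R, OF assms] word_eval_append[of f X])

lemma (in group) pres_lift_gen:
  assumes "f ` X \<subseteq> carrier G"
    and "\<And>r s. (r, s) \<in> R \<Longrightarrow> r \<in> words X \<Longrightarrow> s \<in> words X \<Longrightarrow> word_eval G f r = word_eval G f s"
    and "x \<in> X"
  shows "pres_lift G f (pres_gen X R x) = f x"
  using assms pres_lift_class[of f X R "[(x, True)]", OF assms(1,2)] by (auto simp: pres_gen_def)


section \<open>Torsion, conjugacy classes, and the structure group of a group\<close>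

definition Tor :: "('a, 'm) monoid_scheme \<Rightarrow> 'a set" where
  "Tor H = {x \<in> carrier H. \<exists>n::nat. 0 < n \<and> x [^]\<^bsub>H\<^esub> n = \<one>\<^bsub>H\<^esub>}"

definition conj_class :: "('a, 'm) monoid_scheme \<Rightarrow> 'a \<Rightarrow> 'a set" where
  "conj_class G a = {inv\<^bsub>G\<^esub> g \<otimes>\<^bsub>G\<^esub> a \<otimes>\<^bsub>G\<^esub> g | g. g \<in> carrier G}"

definition conj_classes :: "('a, 'm) monoid_scheme \<Rightarrow> 'a set set" where
  "conj_classes G = conj_class G ` carrier G"

definition A_rels :: "('a, 'm) monoid_scheme \<Rightarrow> ('a word \<times> 'a word) set" where
  "A_rels G = {([(a, True), (b, True)],
                [(b, True), (inv\<^bsub>G\<^esub> b \<otimes>\<^bsub>G\<^esub> a \<otimes>\<^bsub>G\<^esub> b, True)]) | a b.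
                a \<in> carrier G \<and> b \<in> carrier G}"

definition A_group :: "('a, 'm) monoid_scheme \<Rightarrow> 'a word set monoid" where
  "A_group G = presented_group (carrier G) (A_rels G)"

definition A_gen :: "('a, 'm) monoid_scheme \<Rightarrow> 'a \<Rightarrow> 'a word set" where
  "A_gen G a = pres_gen (carrier G) (A_rels G) a"

definition A_pi :: "('a, 'm) monoid_scheme \<Rightarrow> 'a word set \<Rightarrow> 'a" where
  "A_pi G = pres_lift G (\<lambda>a. a)"

definition A_Ab :: "('a, 'm) monoid_scheme \<Rightarrow> 'a word set \<Rightarrow> 'a set \<Rightarrow>\<^sub>0 int" where
  "A_Ab G = pres_lift (free_Abelian_group (conj_classes G)) (\<lambda>a. frag_of (conj_class G a))"

lemma (in group) conj_class_conj:
  assumes "a \<in> carrier G" "b \<in> carrier G"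
  shows "conj_class G (inv b \<otimes> a \<otimes> b) = conj_class G a"
proof -
  have eq: "inv g \<otimes> (inv b \<otimes> a \<otimes> b) \<otimes> g = inv (b \<otimes> g) \<otimes> a \<otimes> (b \<otimes> g)"
    if "g \<in> carrier G" for g
    using that assms by (simp add: m_assoc inv_mult_group)
  have "\<exists>h\<in>carrier G. inv g \<otimes> a \<otimes> g = inv h \<otimes> (inv b \<otimes> a \<otimes> b) \<otimes> h" if "g \<in> carrier G" for g
    using that assms eq[of "inv b \<otimes> g"]
    by (intro bexI[of _ "inv b \<otimes> g"]) (simp_all add: m_assoc[symmetric])
  then show ?thesis
    unfolding conj_class_def using eq assms by (auto, metis m_closed)
qed

lemma group_A_group: "group (A_group G)"
  by (simp add: A_group_def group_presented_group)

lemma (in group) A_pi_hom: "A_pi G \<in> hom (A_group G) G"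
  and A_pi_gen: "a \<in> carrier G \<Longrightarrow> A_pi G (A_gen G a) = a"
proof -
  have 1: "(\<lambda>a. a) ` carrier G \<subseteq> carrier G" by auto
  have 2: "word_eval G (\<lambda>a. a) r = word_eval G (\<lambda>a. a) s" if "(r, s) \<in> A_rels G" for r s
    using that by (auto simp: A_rels_def m_assoc[symmetric])
  show "A_pi G \<in> hom (A_group G) G"
    unfolding A_pi_def A_group_def using 1 2 by (rule pres_lift_hom)
  show "A_pi G (A_gen G a) = a" if "a \<in> carrier G"
    unfolding A_pi_def A_gen_def using 1 2 that by (rule pres_lift_gen)
qed

lemma (in group) A_Ab_hom: "A_Ab G \<in> hom (A_group G) (free_Abelian_group (conj_classes G))"
  and A_Ab_gen: "a \<in> carrier G \<Longrightarrow> A_Ab G (A_gen G a) = frag_of (conj_class G a)"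
proof -
  let ?f = "\<lambda>a. frag_of (conj_class G a)" and ?Z = "free_Abelian_group (conj_classes G)"
  interpret Z: group ?Z by simp
  have 1: "?f ` carrier G \<subseteq> carrier ?Z" by (auto simp: conj_classes_def)
  have 2: "word_eval ?Z ?f r = word_eval ?Z ?f s" if "(r, s) \<in> A_rels G" for r s
    using that by (auto simp: A_rels_def conj_class_conj)
  show "A_Ab G \<in> hom (A_group G) ?Z"
    unfolding A_Ab_def A_group_def using 1 2 by (rule Z.pres_lift_hom)
  show "A_Ab G (A_gen G a) = frag_of (conj_class G a)" if "a \<in> carrier G"
    unfolding A_Ab_def A_gen_def using 1 2 that by (rule Z.pres_lift_gen)
qed


section \<open>C-bar groups\<close>

definition presents ::
    "'g set \<Rightarrow> ('g word \<times> 'g word) set \<Rightarrow> ('g \<Rightarrow> 'a) \<Rightarrow> ('a, 'm) monoid_scheme \<Rightarrow> bool" where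
  "presents X R f G \<longleftrightarrow>
     (\<exists>h \<in> iso (presented_group X R) G. \<forall>x\<in>X. h (pres_gen X R x) = f x)"

text \<open>\<open>(a, b, c) \<in> C\<close> encodes the relation \<open>b\<inverse> a b = c\<close>, and \<open>(a, k) \<in> P\<close> encodes \<open>a\<^sup>k = 1\<close>.\<close>

definition C_bar_rels ::
    "('g \<times> 'g \<times> 'g) set \<Rightarrow> ('g \<times> nat) set \<Rightarrow> ('g word \<times> 'g word) set" where
  "C_bar_rels C P =
     {([(b, False), (a, True), (b, True)], [(c, True)]) | a b c. (a, b, c) \<in> C}
     \<union> {(replicate k (a, True), []) | a k. (a, k) \<in> P}"

definition C_bar_presentation ::
    "'g set \<Rightarrow> ('g \<times> 'g \<times> 'g) set \<Rightarrow> ('g \<times> nat) set \<Rightarrow> ('g \<Rightarrow> 'a) \<Rightarrow>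
     ('a, 'm) monoid_scheme \<Rightarrow> bool" where
  "C_bar_presentation \<Gamma> C P f G \<longleftrightarrow>
     C \<subseteq> \<Gamma> \<times> \<Gamma> \<times> \<Gamma> \<and> P \<subseteq> \<Gamma> \<times> {2..} \<and>
     (\<forall>(a, k)\<in>P. \<forall>(b, l)\<in>P. conj_class G (f a) = conj_class G (f b) \<longrightarrow> (a, k) = (b, l)) \<and>
     presents \<Gamma> (C_bar_rels C P) f G"

text \<open>The generating set is taken inside \<open>G\<close>. This is no restriction: by \<open>C_bar_groupI\<close> below,
  a presentation on generators of any type gives one on their images in \<open>G\<close>.\<close>

definition C_bar_group :: "('a, 'm) monoid_scheme \<Rightarrow> bool" where
  "C_bar_group G \<longleftrightarrow> group G \<and>
     (\<exists>\<Gamma> C P. \<Gamma> \<subseteq> carrier G \<and> C_bar_presentation \<Gamma> C P (\<lambda>a. a) G)"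

lemma presentsD:
  assumes "group G" "presents X R f G"
  shows "f ` X \<subseteq> carrier G"
    and "w \<in> words X \<Longrightarrow> w' \<in> words X \<Longrightarrow>
           word_eval G f w = word_eval G f w' \<longleftrightarrow> pres_eq X R w w'"
    and "carrier G = word_eval G f ` words X"
proof -
  interpret group G by fact
  interpret P: group "presented_group X R" by (rule group_presented_group)
  obtain h where h: "h \<in> iso (presented_group X R) G" "\<And>x. x \<in> X \<Longrightarrow> h (pres_gen X R x) = f x"
    using assms(2) by (auto simp: presents_def)
  interpret h: group_hom "presented_group X R" G h
    using h(1) by unfold_locales (auto simp: iso_def)
  have gen: "pres_class X R [(x, True)] \<in> carrier (presented_group X R)" if "x \<in> X" for x
    using that by (auto simp: carrier_presented_group)
  show f: "f ` X \<subseteq> carrier G"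
    using h(2) h.hom_closed[OF gen] by (fastforce simp: pres_gen_def)
  have ev: "h (pres_class X R w) = word_eval G f w" if "w \<in> words X" for w
    using that
  proof (induction w)
    case Nil
    then show ?case using h.hom_one by (simp add: one_presented_group)
  next
    case (Cons p w)
    obtain x b where p: "p = (x, b)" by force
    have x: "x \<in> X" and w: "w \<in> words X" using Cons p by auto
    have inv: "pres_class X R [(x, False)] = inv\<^bsub>presented_group X R\<^esub> pres_class X R [(x, True)]"
    proof (rule P.inv_equality[symmetric])
      show "pres_class X R [(x, False)] \<otimes>\<^bsub>presented_group X R\<^esub> pres_class X R [(x, True)]
          = \<one>\<^bsub>presented_group X R\<^esub>"
        using x pres_eq.cancel[of "[]" X "[]" x R False]
        by (simp add: mult_presented_group one_presented_group pres_class_eq_iff)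
    qed (use x in \<open>auto simp: carrier_presented_group\<close>)
    have "h (pres_class X R [(x, b)]) = (if b then f x else inv\<^bsub>G\<^esub> (f x))"
      using h(2)[OF x] gen[OF x] inv by (cases b) (auto simp: pres_gen_def)
    moreover have "pres_class X R (p # w)
        = pres_class X R [(x, b)] \<otimes>\<^bsub>presented_group X R\<^esub> pres_class X R w"
      using x w p by (simp add: mult_presented_group)
    moreover have "pres_class X R [(x, b)] \<in> carrier (presented_group X R)"
      "pres_class X R w \<in> carrier (presented_group X R)"
      using x w by (auto simp: carrier_presented_group)
    ultimately show ?case using Cons.IH w p by simp
  qed
  have bij: "bij_betw h (pres_class X R ` words X) (carrier G)"
    using h(1) by (simp add: iso_def carrier_presented_group)
  show "word_eval G f w = word_eval G f w' \<longleftrightarrow> pres_eq X R w w'"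
    if "w \<in> words X" "w' \<in> words X"
  proof -
    have "h (pres_class X R w) = h (pres_class X R w') \<longleftrightarrow> pres_class X R w = pres_class X R w'"
      using that by (intro inj_on_eq_iff[OF bij_betw_imp_inj_on[OF bij]] imageI)
    then show ?thesis using ev[OF that(1)] ev[OF that(2)] pres_class_eq_iff[OF that(1)] by simp
  qed
  show "carrier G = word_eval G f ` words X"
    unfolding bij_betw_imp_surj_on[OF bij, symmetric] image_image by (intro image_cong HOL.refl ev)
qed

lemma presentsI:
  assumes "group G" "f ` X \<subseteq> carrier G"
    and "\<And>r s. (r, s) \<in> R \<Longrightarrow> r \<in> words X \<Longrightarrow> s \<in> words X \<Longrightarrow> word_eval G f r = word_eval G f s"
    and "\<And>w w'. w \<in> words X \<Longrightarrow> w' \<in> words X \<Longrightarrow> word_eval G f w = word_eval G f w' \<Longrightarrow>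
           pres_eq X R w w'"
    and "carrier G = word_eval G f ` words X"
  shows "presents X R f G"
proof -
  interpret group G by fact
  have cl: "pres_lift G f (pres_class X R w) = word_eval G f w" if "w \<in> words X" for w
    using assms(2,3) that by (rule pres_lift_class)
  have "inj_on (pres_lift G f) (pres_class X R ` words X)"
  proof (rule inj_onI)
    fix U V assume U: "U \<in> pres_class X R ` words X" and V: "V \<in> pres_class X R ` words X"
      and eq: "pres_lift G f U = pres_lift G f V"
    from U V obtain u v where
      uv: "u \<in> words X" "v \<in> words X" "U = pres_class X R u" "V = pres_class X R v"
      by (elim imageE)
    have "word_eval G f u = word_eval G f v" using eq unfolding uv cl[OF uv(1)] cl[OF uv(2)] .
    then have "pres_eq X R u v" using uv by (intro assms(4))
    then show "U = V" using uv by (simp add: pres_class_eq_iff)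
  qed
  moreover have "pres_lift G f ` pres_class X R ` words X = carrier G"
    unfolding assms(5) image_image by (intro image_cong HOL.refl cl)
  ultimately have "pres_lift G f \<in> iso (presented_group X R) G"
    using pres_lift_hom[of f X R, OF assms(2,3)] by (simp add: iso_iff carrier_presented_group)
  then show ?thesis
    unfolding presents_def using assms(2,3)
    by (intro bexI[of _ "pres_lift G f"] ballI pres_lift_gen)
qed

lemma word_eval_map:
  "word_eval G g (map (apfst f) w) = word_eval G (\<lambda>x. g (f x)) w"
  by (induction w) auto

lemma map_words: "w \<in> words X \<Longrightarrow> map (apfst f) w \<in> words (f ` X)"
  by (induction w) auto

lemma words_image: "w \<in> words (f ` X) \<Longrightarrow> \<exists>v\<in>words X. map (apfst f) v = w"
proof (induction w)
  case (Cons p w)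
  then obtain x where "x \<in> X" "fst p = f x" by auto
  moreover obtain v where "v \<in> words X" "map (apfst f) v = w" using Cons by auto
  ultimately show ?case by (intro bexI[of _ "(x, snd p) # v"]) (auto simp: prod_eq_iff)
qed (auto intro: bexI[of _ "[]"])

lemma pres_eq_map:
  assumes "\<And>r s. (r, s) \<in> R \<Longrightarrow> (map (apfst f) r, map (apfst f) s) \<in> R'"
  shows "pres_eq X R u v \<Longrightarrow>
    pres_eq (f ` X) R' (map (apfst f) u) (map (apfst f) v)"
proof (induction rule: pres_eq.induct)
  case (cancel u v x b)
  then show ?case
    using pres_eq.cancel[of "map (apfst f) u" "f ` X" "map (apfst f) v" "f x" R' b]
    by (simp add: map_words)
next
  case (rel u v r s)
  then show ?case using assms by (simp add: map_words pres_eq.rel)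
qed (simp_all add: pres_eq.refl pres_eq.sym map_words, meson pres_eq.trans)

lemma C_bar_groupI:
  assumes G: "group G" and pr: "C_bar_presentation \<Gamma> C P f G"
  shows "C_bar_group G"
proof -
  interpret group G by fact
  define C' where "C' = (\<lambda>(a, b, c). (f a, f b, f c)) ` C"
  define P' where "P' = (\<lambda>(a, k). (f a, k)) ` P"
  let ?R = "C_bar_rels C P" and ?R' = "C_bar_rels C' P'" and ?m = "map (apfst f)"
  have CP: "C \<subseteq> \<Gamma> \<times> \<Gamma> \<times> \<Gamma>" "P \<subseteq> \<Gamma> \<times> {2..}"
    and uni: "\<forall>(a, k)\<in>P. \<forall>(b, l)\<in>P. conj_class G (f a) = conj_class G (f b) \<longrightarrow> (a, k) = (b, l)"
    and pres: "presents \<Gamma> ?R f G"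
    using pr by (auto simp: C_bar_presentation_def)
  note D = presentsD[OF G pres]
  have R': "(r, s) \<in> ?R' \<longleftrightarrow> (\<exists>r0 s0. (r0, s0) \<in> ?R \<and> r = ?m r0 \<and> s = ?m s0)" for r s
  proof
    assume "(r, s) \<in> ?R'"
    then consider a b c where "(a, b, c) \<in> C" "r = [(f b, False), (f a, True), (f b, True)]" "s = [(f c, True)]"
      | a k where "(a, k) \<in> P" "r = replicate k (f a, True)" "s = []"
      by (auto simp: C_bar_rels_def C'_def P'_def)
    then show "\<exists>r0 s0. (r0, s0) \<in> ?R \<and> r = ?m r0 \<and> s = ?m s0"
    proof cases
      case 1
      then show ?thesis
        by (intro exI[of _ "[(b, False), (a, True), (b, True)]"] exI[of _ "[(c, True)]"])
          (auto simp: C_bar_rels_def)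
    next
      case 2
      then show ?thesis
        by (intro exI[of _ "replicate k (a, True)"] exI[of _ "[]"])
          (auto simp: C_bar_rels_def)
    qed
  next
    assume "\<exists>r0 s0. (r0, s0) \<in> ?R \<and> r = ?m r0 \<and> s = ?m s0"
    then show "(r, s) \<in> ?R'"
      by (force simp: C_bar_rels_def C'_def P'_def)
  qed
  have Rw: "r \<in> words \<Gamma> \<and> s \<in> words \<Gamma>" if "(r, s) \<in> ?R" for r s
    using that CP by (auto simp: C_bar_rels_def words_def)
  have "presents (f ` \<Gamma>) ?R' (\<lambda>a. a) G"
  proof (rule presentsI[OF G])
    show "(\<lambda>a. a) ` f ` \<Gamma> \<subseteq> carrier G" using D(1) by simp
    show "word_eval G (\<lambda>a. a) r = word_eval G (\<lambda>a. a) s" if rs: "(r, s) \<in> ?R'" for r s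
    proof -
      obtain r0 s0 where 0: "(r0, s0) \<in> ?R" "r = ?m r0" "s = ?m s0"
        using rs R' by blast
      have "pres_eq \<Gamma> ?R r0 s0"
        using pres_eq.rel[of "[]" \<Gamma> "[]" r0 s0 ?R] Rw[OF 0(1)] 0(1) by simp
      then show ?thesis using 0 Rw[OF 0(1)] D(2)[of r0 s0] by (simp add: word_eval_map)
    qed
    show "pres_eq (f ` \<Gamma>) ?R' w w'"
      if w: "w \<in> words (f ` \<Gamma>)" "w' \<in> words (f ` \<Gamma>)"
        "word_eval G (\<lambda>a. a) w = word_eval G (\<lambda>a. a) w'" for w w'
    proof -
      obtain v v' where v: "v \<in> words \<Gamma>" "v' \<in> words \<Gamma>" "w = ?m v" "w' = ?m v'"
        using words_image w by metis
      then have "pres_eq \<Gamma> ?R v v'" using w(3) D(2) by (simp add: word_eval_map)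
      then show ?thesis unfolding v using R' by (intro pres_eq_map[of ?R]) auto
    qed
    show "carrier G = word_eval G (\<lambda>a. a) ` words (f ` \<Gamma>)"
    proof -
      have "words (f ` \<Gamma>) = ?m ` words \<Gamma>" using words_image[of _ f \<Gamma>] map_words[of _ \<Gamma> f] by blast
      then show ?thesis using D(3) by (simp add: image_image word_eval_map)
    qed
  qed
  moreover have "C' \<subseteq> f ` \<Gamma> \<times> f ` \<Gamma> \<times> f ` \<Gamma>" "P' \<subseteq> f ` \<Gamma> \<times> {2..}"
    using CP by (auto simp: C'_def P'_def)
  moreover have "\<forall>(a, k)\<in>P'. \<forall>(b, l)\<in>P'. conj_class G a = conj_class G b \<longrightarrow> (a, k) = (b, l)"
    using uni by (fastforce simp: P'_def)
  ultimately have "C_bar_presentation (f ` \<Gamma>) C' P' (\<lambda>a. a) G"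
    by (simp add: C_bar_presentation_def)
  then show ?thesis
    unfolding C_bar_group_def using G D(1) by blast
qed


section \<open>Isomorphisms between subsets of groups\<close>

text \<open>\<open>Tor G\<close> and \<open>Tor (A_group G)\<close> are sets of elements and need not be closed under
  multiplication, even for a C-bar group \<open>G\<close>: for the affine Weyl group of type \<open>A\<^sub>2\<close>
  the commutator subgroup contains rotations of order 3 whose product is a translation.
  They carry the partial multiplication inherited from the ambient group. The following is
  isomorphism for these partial multiplications; if \<open>S\<close> and \<open>T\<close> are subgroups it is the usual
  notion of a group isomorphism.\<close>

definition partial_iso ::
    "('a \<Rightarrow> 'b) \<Rightarrow> ('a, 'm) monoid_scheme \<Rightarrow> 'a set \<Rightarrow> ('b, 'n) monoid_scheme \<Rightarrow> 'b set \<Rightarrow> bool" where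
  "partial_iso f A S G T \<longleftrightarrow> bij_betw f S T \<and>
     (\<forall>x\<in>S. \<forall>y\<in>S. (x \<otimes>\<^bsub>A\<^esub> y \<in> S \<longleftrightarrow> f x \<otimes>\<^bsub>G\<^esub> f y \<in> T) \<and>
        (x \<otimes>\<^bsub>A\<^esub> y \<in> S \<longrightarrow> f (x \<otimes>\<^bsub>A\<^esub> y) = f x \<otimes>\<^bsub>G\<^esub> f y))"

lemma partial_iso_iff_iso:
  assumes "subgroup S A" "subgroup T G"
  shows "partial_iso f A S G T \<longleftrightarrow> f \<in> iso (A\<lparr>carrier := S\<rparr>) (G\<lparr>carrier := T\<rparr>)"
  using subgroup.m_closed[OF assms(1)] subgroup.m_closed[OF assms(2)]
  by (auto simp: partial_iso_def iso_def hom_def bij_betw_def)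

end

theory Submission
  imports Defs
begin

text \<open>Torsion dies in the free abelian group, so everything reduces to the injectivity of \<open>\<pi>\<close> on the
  kernel of \<open>Ab\<close>. The kernel of \<open>\<pi>\<close> is central. Let \<open>N\<close> be the central subgroup of \<open>A(G)\<close> generated
  by the elements \<open>e\<^sub>a\<^sup>k\<close> for the power relations \<open>a\<^sup>k = 1\<close>. Modulo \<open>N\<close> the projection \<open>\<pi>\<close> splits by
  \<open>\<gamma> \<mapsto> e\<^sub>\<gamma>\<close>, and \<open>e\<^sub>a\<close> differs from the image of \<open>a\<close> under this splitting by a central element
  depending only on the conjugacy class of \<open>a\<close>. Hence modulo \<open>N\<close> an element is determined by its
  images under \<open>\<pi>\<close> and \<open>Ab\<close>, so their common kernel lies in \<open>N\<close>; and \<open>Ab\<close> is injective on \<open>N\<close>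
  as the power relations lie in distinct classes.\<close>

section \<open>Presented groups: induction over letters and comparison of homomorphisms\<close>

lemma pres_gen_closed: "x \<in> X \<Longrightarrow> pres_gen X R x \<in> carrier (presented_group X R)"
  by (auto simp: pres_gen_def carrier_presented_group)

lemma pres_class_False:
  assumes "x \<in> X"
  shows "pres_class X R [(x, False)] = inv\<^bsub>presented_group X R\<^esub> pres_gen X R x"
proof -
  interpret P: group "presented_group X R" by (rule group_presented_group)
  show ?thesis
  proof (rule P.inv_equality[symmetric])
    show "pres_class X R [(x, False)] \<otimes>\<^bsub>presented_group X R\<^esub> pres_gen X R x
        = \<one>\<^bsub>presented_group X R\<^esub>"
      using assms pres_eq.cancel[of "[]" X "[]" x R False]
      by (simp add: pres_gen_def mult_presented_group one_presented_group pres_class_eq_iff)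
  qed (use assms in \<open>auto simp: carrier_presented_group pres_gen_def\<close>)
qed

text \<open>Peel off the first letter of a representing word. The rule speaks of group elements
  only, so later inductions never handle words or their classes.\<close>

lemma presented_group_induct [consumes 1, case_names one gen inv_gen]:
  assumes "U \<in> carrier (presented_group X R)"
    and one: "Q \<one>\<^bsub>presented_group X R\<^esub>"
    and gen: "\<And>x V. x \<in> X \<Longrightarrow> V \<in> carrier (presented_group X R) \<Longrightarrow> Q V \<Longrightarrow>
      Q (pres_gen X R x \<otimes>\<^bsub>presented_group X R\<^esub> V)"
    and inv_gen: "\<And>x V. x \<in> X \<Longrightarrow> V \<in> carrier (presented_group X R) \<Longrightarrow> Q V \<Longrightarrow>
      Q (inv\<^bsub>presented_group X R\<^esub> pres_gen X R x \<otimes>\<^bsub>presented_group X R\<^esub> V)"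
  shows "Q U"
proof -
  have "Q (pres_class X R w)" if "w \<in> words X" for w
    using that
  proof (induction w)
    case Nil
    then show ?case using one by (simp add: one_presented_group)
  next
    case (Cons p w)
    obtain x b where p: "p = (x, b)" by force
    have x: "x \<in> X" and w: "w \<in> words X" using Cons p by auto
    have "pres_class X R (p # w)
        = pres_class X R [(x, b)] \<otimes>\<^bsub>presented_group X R\<^esub> pres_class X R w"
      using x w p by (simp add: mult_presented_group)
    moreover have "pres_class X R w \<in> carrier (presented_group X R)"
      using w by (simp add: carrier_presented_group)
    ultimately show ?case
      using Cons.IH[OF w] gen[OF x] inv_gen[OF x] pres_class_False[OF x, of R]
      by (cases b) (auto simp: pres_gen_def)
  qed
  then show ?thesis using assms(1) by (auto simp: carrier_presented_group)
qed

text \<open>The generators generate. This is how the quotient map modulo the central subgroup is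
  later identified with an explicit formula.\<close>

lemma presented_group_hom_eq:
  assumes "group H" "f \<in> hom (presented_group X R) H" "g \<in> hom (presented_group X R) H"
    and eq: "\<And>x. x \<in> X \<Longrightarrow> f (pres_gen X R x) = g (pres_gen X R x)"
    and "U \<in> carrier (presented_group X R)"
  shows "f U = g U"
proof -
  interpret P: group "presented_group X R" by (rule group_presented_group)
  interpret f: group_hom "presented_group X R" H f
    using assms by (simp add: group_hom_def group_hom_axioms_def P.is_group)
  interpret g: group_hom "presented_group X R" H g
    using assms by (simp add: group_hom_def group_hom_axioms_def P.is_group)
  show ?thesis
    using assms(5)
    by (induction rule: presented_group_induct) (simp_all add: pres_gen_closed eq)
qed

lemma (in group_hom) word_eval_hom:
  assumes "f ` X \<subseteq> carrier G" "w \<in> words X"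
  shows "h (word_eval G f w) = word_eval H (\<lambda>x. h (f x)) w"
  using assms(2)
proof (induction w)
  case (Cons p w)
  then show ?case
    using assms(1) G.word_eval_closed[of f X w] by (cases p) auto
qed simp

lemma (in group) word_eval_replicate:
  "f a \<in> carrier G \<Longrightarrow> word_eval G f (replicate k (a, True)) = f a [^] k"
proof (induction k)
  case (Suc k)
  then show ?case by (simp add: nat_pow_Suc2[symmetric] del: nat_pow_Suc)
qed simp

section \<open>The structure group: conjugation of generators, the central kernel of \<pi>,
  torsion\<close>

lemmas A_group_induct [consumes 1, case_names one gen inv_gen] =
  presented_group_induct[of _ "carrier G" "A_rels G" for G, folded A_group_def A_gen_def]

context group
begin

lemma A_gen_closed: "a \<in> carrier G \<Longrightarrow> A_gen G a \<in> carrier (A_group G)"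
  by (simp add: A_gen_def A_group_def pres_gen_closed)

lemma A_pi_group_hom: "group_hom (A_group G) G (A_pi G)"
  by (simp add: group_hom_def group_hom_axioms_def group_A_group is_group A_pi_hom)

lemma A_Ab_group_hom: "group_hom (A_group G) (free_Abelian_group (conj_classes G)) (A_Ab G)"
  by (simp add: group_hom_def group_hom_axioms_def group_A_group A_Ab_hom)

lemma A_gen_commute:
  assumes "a \<in> carrier G" "b \<in> carrier G"
  shows "A_gen G a \<otimes>\<^bsub>A_group G\<^esub> A_gen G b = A_gen G b \<otimes>\<^bsub>A_group G\<^esub> A_gen G (inv b \<otimes> a \<otimes> b)"
proof -
  have "pres_eq (carrier G) (A_rels G) ([] @ [(a, True), (b, True)] @ [])
      ([] @ [(b, True), (inv b \<otimes> a \<otimes> b, True)] @ [])"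
    using assms by (intro pres_eq.rel) (auto simp: A_rels_def)
  then show ?thesis
    using assms by (simp add: A_gen_def A_group_def pres_gen_def mult_presented_group pres_class_eq_iff)
qed

text \<open>Iterate the defining relation along the letters of \<open>x\<close>: each letter
  conjugates the index of the generator that passes it, so in total the index is conjugated by the
  image of \<open>x\<close> in \<open>G\<close>.\<close>

lemma A_gen_conj:
  assumes "x \<in> carrier (A_group G)" "a \<in> carrier G"
  shows "A_gen G a \<otimes>\<^bsub>A_group G\<^esub> x =
    x \<otimes>\<^bsub>A_group G\<^esub> A_gen G (inv (A_pi G x) \<otimes> a \<otimes> A_pi G x)"
proof -
  interpret A: group "A_group G" by (rule group_A_group)
  interpret pi: group_hom "A_group G" G "A_pi G" by (rule A_pi_group_hom)
  \<comment> \<open>The quantifier over \<open>a\<close> belongs to the induction claim because the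
    induction hypothesis is applied to the conjugate \<open>?c\<close>, not to
    \<open>a\<close>.\<close>
  have "\<forall>a\<in>carrier G. A_gen G a \<otimes>\<^bsub>A_group G\<^esub> x =
      x \<otimes>\<^bsub>A_group G\<^esub> A_gen G (inv (A_pi G x) \<otimes> a \<otimes> A_pi G x)"
    using assms(1)
  proof (induction rule: A_group_induct)
    case one
    then show ?case by (simp add: A_gen_closed)
  next
    case (gen b y)
    show ?case
    proof
      fix a assume a: "a \<in> carrier G"
      let ?c = "inv b \<otimes> a \<otimes> b"
      have c: "?c \<in> carrier G" using a gen by simp
      note [simp] = A_gen_closed a c gen(1,2) A_pi_gen
      have "A_gen G a \<otimes>\<^bsub>A_group G\<^esub> (A_gen G b \<otimes>\<^bsub>A_group G\<^esub> y)
          = A_gen G b \<otimes>\<^bsub>A_group G\<^esub> (A_gen G ?c \<otimes>\<^bsub>A_group G\<^esub> y)"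
        by (simp add: A.m_assoc[symmetric] A_gen_commute[of a b])
      also have "\<dots> = A_gen G b \<otimes>\<^bsub>A_group G\<^esub>
          (y \<otimes>\<^bsub>A_group G\<^esub> A_gen G (inv (A_pi G y) \<otimes> ?c \<otimes> A_pi G y))"
        using gen(3) c by simp
      finally show "A_gen G a \<otimes>\<^bsub>A_group G\<^esub> (A_gen G b \<otimes>\<^bsub>A_group G\<^esub> y) =
          A_gen G b \<otimes>\<^bsub>A_group G\<^esub> y \<otimes>\<^bsub>A_group G\<^esub>
            A_gen G (inv A_pi G (A_gen G b \<otimes>\<^bsub>A_group G\<^esub> y) \<otimes> a \<otimes>
              A_pi G (A_gen G b \<otimes>\<^bsub>A_group G\<^esub> y))"
        by (simp add: A.m_assoc m_assoc inv_mult_group)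
    qed
  next
    case (inv_gen b y)
    show ?case
    proof
      fix a assume a: "a \<in> carrier G"
      \<comment> \<open>This conjugate solves \<open>inv b \<otimes> ?c \<otimes> b = a\<close>, so
        the defining relation for the pair \<open>?c\<close>, \<open>b\<close> expresses the
        generator of \<open>a\<close> as a conjugate of that of \<open>?c\<close>.\<close>
      let ?c = "b \<otimes> a \<otimes> inv b"
      have c: "?c \<in> carrier G" using a inv_gen by simp
      note [simp] = A_gen_closed a c inv_gen(1,2) A_pi_gen
      have "inv b \<otimes> ?c \<otimes> b = a"
        by (simp add: m_assoc) (simp add: m_assoc[symmetric])
      then have "A_gen G ?c \<otimes>\<^bsub>A_group G\<^esub> A_gen G b = A_gen G b \<otimes>\<^bsub>A_group G\<^esub> A_gen G a"
        using A_gen_commute[OF c, of b] by simp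
      then have "A_gen G a = inv\<^bsub>A_group G\<^esub> A_gen G b \<otimes>\<^bsub>A_group G\<^esub> A_gen G ?c \<otimes>\<^bsub>A_group G\<^esub> A_gen G b"
        by (simp add: A.m_assoc A.inv_solve_left)
      then have "A_gen G a \<otimes>\<^bsub>A_group G\<^esub> (inv\<^bsub>A_group G\<^esub> A_gen G b \<otimes>\<^bsub>A_group G\<^esub> y)
          = inv\<^bsub>A_group G\<^esub> A_gen G b \<otimes>\<^bsub>A_group G\<^esub> A_gen G ?c \<otimes>\<^bsub>A_group G\<^esub>
            (A_gen G b \<otimes>\<^bsub>A_group G\<^esub> inv\<^bsub>A_group G\<^esub> A_gen G b) \<otimes>\<^bsub>A_group G\<^esub> y"
        by (simp only: A.m_assoc A.m_closed A.inv_closed A_gen_closed a c inv_gen(1,2))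
      also have "\<dots> = inv\<^bsub>A_group G\<^esub> A_gen G b \<otimes>\<^bsub>A_group G\<^esub> (A_gen G ?c \<otimes>\<^bsub>A_group G\<^esub> y)"
        by (simp add: A.m_assoc)
      also have "\<dots> = inv\<^bsub>A_group G\<^esub> A_gen G b \<otimes>\<^bsub>A_group G\<^esub>
          (y \<otimes>\<^bsub>A_group G\<^esub> A_gen G (inv (A_pi G y) \<otimes> ?c \<otimes> A_pi G y))"
        using inv_gen(3) c by simp
      finally show "A_gen G a \<otimes>\<^bsub>A_group G\<^esub> (inv\<^bsub>A_group G\<^esub> A_gen G b \<otimes>\<^bsub>A_group G\<^esub> y) =
          inv\<^bsub>A_group G\<^esub> A_gen G b \<otimes>\<^bsub>A_group G\<^esub> y \<otimes>\<^bsub>A_group G\<^esub>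
            A_gen G (inv A_pi G (inv\<^bsub>A_group G\<^esub> A_gen G b \<otimes>\<^bsub>A_group G\<^esub> y) \<otimes> a \<otimes>
              A_pi G (inv\<^bsub>A_group G\<^esub> A_gen G b \<otimes>\<^bsub>A_group G\<^esub> y))"
        by (simp add: A.m_assoc m_assoc inv_mult_group)
    qed
  qed
  then show ?thesis using assms(2) by blast
qed

text \<open>By \<open>A_gen_conj\<close> an element \<open>z\<close> with trivial image in
  \<open>G\<close> leaves the index of every generator unchanged. So it commutes with the
  generators, hence with everything.\<close>

lemma kernel_A_pi_central:
  assumes "z \<in> kernel (A_group G) G (A_pi G)" "x \<in> carrier (A_group G)"
  shows "z \<otimes>\<^bsub>A_group G\<^esub> x = x \<otimes>\<^bsub>A_group G\<^esub> z"
proof -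
  interpret A: group "A_group G" by (rule group_A_group)
  have z: "z \<in> carrier (A_group G)" "A_pi G z = \<one>" using assms(1) by (auto simp: kernel_def)
  have comm: "A_gen G a \<otimes>\<^bsub>A_group G\<^esub> z = z \<otimes>\<^bsub>A_group G\<^esub> A_gen G a" if "a \<in> carrier G" for a
    using A_gen_conj[OF z(1) that] z(2) that by simp
  show ?thesis
    using assms(2)
  proof (induction rule: A_group_induct)
    case one
    then show ?case using z by simp
  next
    case (gen a y)
    then show ?case using z comm[of a]
      by (metis A.m_assoc A_gen_closed)
  next
    case (inv_gen a y)
    have "inv\<^bsub>A_group G\<^esub> A_gen G a \<otimes>\<^bsub>A_group G\<^esub> z = z \<otimes>\<^bsub>A_group G\<^esub> inv\<^bsub>A_group G\<^esub> A_gen G a"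
      using comm[of a] inv_gen(1) z A_gen_closed[of a]
      by (metis A.inv_closed A.inv_solve_left A.inv_solve_right A.m_assoc A.m_closed)
    then show ?case using inv_gen z A_gen_closed[of a]
      by (metis A.m_assoc A.inv_closed)
  qed
qed

text \<open>The universal property of free abelian groups needs a commutative target. The central
  kernel serves as that target, since the structure group itself need not be commutative.\<close>

lemma comm_group_kernel_A_pi:
  "comm_group ((A_group G)\<lparr>carrier := kernel (A_group G) G (A_pi G)\<rparr>)"
proof -
  interpret pi: group_hom "A_group G" G "A_pi G" by (rule A_pi_group_hom)
  have "group ((A_group G)\<lparr>carrier := kernel (A_group G) G (A_pi G)\<rparr>)"
    using pi.subgroup_kernel by (rule pi.G.subgroup_imp_group)
  then show ?thesis
    by (rule group.group_comm_groupI) (auto simp: kernel_A_pi_central kernel_def)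
qed


text \<open>A basis element \<open>(a, k)\<close> goes to the \<open>k\<close>-th power of the
  generator of \<open>a\<close>, which \<open>A_Ab\<close> sends to \<open>k\<close> times the basis
  vector of the class of \<open>a\<close>. Distinct pairs have distinct classes, so the coordinates
  do not mix. This yields injectivity of \<open>A_Ab\<close> on products of such powers once all
  exponents are nonzero.\<close>

lemma A_Ab_lookup_power_product:
  assumes "P \<subseteq> carrier G \<times> UNIV"
    and inj: "\<And>a k b l. (a, k) \<in> P \<Longrightarrow> (b, l) \<in> P \<Longrightarrow>
      conj_class G a = conj_class G b \<Longrightarrow> (a, k) = (b, l)"
    and \<psi>: "\<psi> \<in> hom (free_Abelian_group P) (A_group G)"
      "\<And>a k. (a, k) \<in> P \<Longrightarrow> \<psi> (frag_of (a, k)) = A_gen G a [^]\<^bsub>A_group G\<^esub> (k::nat)"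
    and "(a, k) \<in> P" "Poly_Mapping.keys y \<subseteq> P"
  shows "Poly_Mapping.lookup (A_Ab G (\<psi> y)) (conj_class G a) = int k * Poly_Mapping.lookup y (a, k)"
proof -
  interpret Ab: group_hom "A_group G" "free_Abelian_group (conj_classes G)" "A_Ab G"
    by (rule A_Ab_group_hom)
  interpret \<psi>: group_hom "free_Abelian_group P" "A_group G" \<psi>
    using \<psi>(1) by (simp add: group_hom_def group_hom_axioms_def group_A_group)
  show ?thesis
    using assms(6)
  proof (induction rule: free_Abelian_group_induct[consumes 1, case_names zero diff frag])
    case zero
    then show ?case using \<psi>.hom_one Ab.hom_one by simp
  next
    case (diff x y)
    have "x - y = x \<otimes>\<^bsub>free_Abelian_group P\<^esub> inv\<^bsub>free_Abelian_group P\<^esub> y"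
      using diff by simp
    then have "\<psi> (x - y) = \<psi> x \<otimes>\<^bsub>A_group G\<^esub> inv\<^bsub>A_group G\<^esub> \<psi> y"
      using diff by (metis \<psi>.G.inv_closed \<psi>.hom_inv \<psi>.hom_mult carrier_free_Abelian_group_iff)
    moreover have c: "\<psi> x \<in> carrier (A_group G)" "\<psi> y \<in> carrier (A_group G)"
      using diff by (auto intro!: \<psi>.hom_closed)
    moreover have "Poly_Mapping.keys (A_Ab G (\<psi> y)) \<subseteq> conj_classes G"
      using Ab.hom_closed[OF c(2)] by simp
    ultimately have "A_Ab G (\<psi> (x - y)) = A_Ab G (\<psi> x) - A_Ab G (\<psi> y)"
      by simp
    then show ?case using diff by (simp add: lookup_minus right_diff_distrib)
  next
    case (frag p)
    obtain b l where p: "p = (b, l)" by force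
    have b: "b \<in> carrier G" using frag p assms(1) by auto
    have "A_Ab G (\<psi> (frag_of p)) = frag_cmul (int l) (frag_of (conj_class G b))"
      using frag p b by (simp add: \<psi>(2) A_gen_closed Ab.hom_nat_pow A_Ab_gen)
    \<comment> \<open>If \<open>(b, l)\<close> differs from \<open>(a, k)\<close>, then by
      \<open>inj\<close> the classes differ too, and both sides vanish.\<close>
    then show ?case
      using inj[OF assms(5), of b l] frag p by (auto simp: lookup_single when_def)
  qed
qed

text \<open>The free abelian group is torsion-free, so \<open>A_Ab\<close> kills torsion.
  Conversely, if \<open>A_Ab\<close> kills \<open>x\<close> and the \<open>n\<close>-th power of the
  image of \<open>x\<close> in \<open>G\<close> is trivial, then the \<open>n\<close>-th power of
  \<open>x\<close> lies in both kernels.\<close>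

lemma Tor_A_group:
  assumes "kernel (A_group G) G (A_pi G) \<inter>
      kernel (A_group G) (free_Abelian_group (conj_classes G)) (A_Ab G) \<subseteq> {\<one>\<^bsub>A_group G\<^esub>}"
  shows "Tor (A_group G) =
    kernel (A_group G) (free_Abelian_group (conj_classes G)) (A_Ab G) \<inter> A_pi G -` Tor G"
proof -
  interpret pi: group_hom "A_group G" G "A_pi G" by (rule A_pi_group_hom)
  interpret Ab: group_hom "A_group G" "free_Abelian_group (conj_classes G)" "A_Ab G"
    by (rule A_Ab_group_hom)
  have 1: "A_Ab G x = 0 \<and> A_pi G x \<in> Tor G"
    if x: "x \<in> carrier (A_group G)" "0 < n" "x [^]\<^bsub>A_group G\<^esub> n = \<one>\<^bsub>A_group G\<^esub>" for x and n :: nat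
  proof
    have "frag_cmul (int n) (A_Ab G x) = 0"
      using Ab.hom_nat_pow[OF x(1), of n] x by simp
    then show "A_Ab G x = 0" using x(2) by simp
    have "A_pi G x [^] n = \<one>" using pi.hom_nat_pow[OF x(1), of n] x by simp
    then show "A_pi G x \<in> Tor G" using x by (auto simp: Tor_def)
  qed
  have 2: "x [^]\<^bsub>A_group G\<^esub> n = \<one>\<^bsub>A_group G\<^esub>"
    if x: "x \<in> carrier (A_group G)" "A_Ab G x = 0" "A_pi G x [^] n = \<one>" for x and n :: nat
  proof -
    have "A_Ab G (x [^]\<^bsub>A_group G\<^esub> n) = 0" "A_pi G (x [^]\<^bsub>A_group G\<^esub> n) = \<one>"
      using Ab.hom_nat_pow[OF x(1), of n] pi.hom_nat_pow[OF x(1), of n] x by simp_all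
    then show ?thesis using assms x(1) by (auto simp: kernel_def)
  qed
  show ?thesis
  proof (intro subset_antisym subsetI)
    fix x assume "x \<in> Tor (A_group G)"
    then obtain n :: nat where x: "x \<in> carrier (A_group G)" "0 < n" "x [^]\<^bsub>A_group G\<^esub> n = \<one>\<^bsub>A_group G\<^esub>"
      by (auto simp: Tor_def)
    then show "x \<in> kernel (A_group G) (free_Abelian_group (conj_classes G)) (A_Ab G) \<inter> A_pi G -` Tor G"
      using 1[OF x] by (simp add: kernel_def)
  next
    fix x assume "x \<in> kernel (A_group G) (free_Abelian_group (conj_classes G)) (A_Ab G) \<inter> A_pi G -` Tor G"
    then obtain n :: nat where "x \<in> carrier (A_group G)" "A_Ab G x = 0" "0 < n" "A_pi G x [^] n = \<one>"
      by (auto simp: Tor_def kernel_def)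
    then show "x \<in> Tor (A_group G)"
      using 2[of x n] by (auto simp: Tor_def)
  qed
qed

section \<open>Triviality of the common kernel of \<pi> and \<open>A_Ab\<close>\<close>

lemma kernel_A_pi_Int_kernel_A_Ab:
  assumes "\<Gamma> \<subseteq> carrier G" "C_bar_presentation \<Gamma> C P (\<lambda>a. a) G"
  shows "kernel (A_group G) G (A_pi G) \<inter>
      kernel (A_group G) (free_Abelian_group (conj_classes G)) (A_Ab G) \<subseteq> {\<one>\<^bsub>A_group G\<^esub>}"
proof -
  define A where "A = A_group G"
  define e where "e = A_gen G"
  define Z where "Z = kernel A G (A_pi G)"
  define F where "F = free_Abelian_group (conj_classes G)"
  define ev where "ev = word_eval G (\<lambda>a. a)"
  have CP: "C \<subseteq> \<Gamma> \<times> \<Gamma> \<times> \<Gamma>" "P \<subseteq> \<Gamma> \<times> {2..}"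
    and inj: "\<And>a k b l. (a, k) \<in> P \<Longrightarrow> (b, l) \<in> P \<Longrightarrow>
      conj_class G a = conj_class G b \<Longrightarrow> (a, k) = (b, l)"
    and pres: "presents \<Gamma> (C_bar_rels C P) (\<lambda>a. a) G"
    using assms(2) by (auto simp: C_bar_presentation_def)
  note D = presentsD[OF is_group pres, folded ev_def]
  interpret A: group A unfolding A_def by (rule group_A_group)
  interpret pi: group_hom A G "A_pi G" unfolding A_def by (rule A_pi_group_hom)
  interpret Ab: group_hom A F "A_Ab G" unfolding A_def F_def by (rule A_Ab_group_hom)
  interpret Z: subgroup Z A unfolding Z_def by (rule pi.subgroup_kernel)
  interpret ZC: comm_group "A\<lparr>carrier := Z\<rparr>"
    unfolding Z_def A_def by (rule comm_group_kernel_A_pi)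
  have central: "z \<otimes>\<^bsub>A\<^esub> x = x \<otimes>\<^bsub>A\<^esub> z" if "z \<in> Z" "x \<in> carrier A" for z x
    using kernel_A_pi_central that by (simp add: A_def Z_def)
  have e: "e a \<in> carrier A" "A_pi G (e a) = a" "A_Ab G (e a) = frag_of (conj_class G a)"
    if "a \<in> carrier G" for a
    using that by (simp_all add: e_def A_def A_gen_closed A_pi_gen A_Ab_gen)
  have hom_A: "h \<in> hom K A" if "h \<in> hom K (A\<lparr>carrier := Z\<rparr>)" for h and K :: "('z \<Rightarrow>\<^sub>0 int) monoid"
    using that Z.subset by (auto simp: hom_def)
  have rel: "ev r = ev s" if "(r, s) \<in> C_bar_rels C P" "r \<in> words \<Gamma>" "s \<in> words \<Gamma>" for r s
    using pres_eq.rel[of "[]" \<Gamma> "[]" r s "C_bar_rels C P"] that D(2) by simp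
  \<comment> \<open>The power relation holds in \<open>G\<close>, so the corresponding power of
    \<open>e a\<close> lies in the kernel of \<pi>.\<close>
  have pow: "e a [^]\<^bsub>A\<^esub> k \<in> Z" if "(a, k) \<in> P" for a k
  proof -
    have a: "a \<in> \<Gamma>" "a \<in> carrier G" using that CP assms(1) by auto
    have "ev (replicate k (a, True)) = ev []"
      using that a by (intro rel) (auto simp: C_bar_rels_def words_def)
    then have "a [^] k = \<one>" using a by (simp add: ev_def word_eval_replicate)
    then have "A_pi G (e a [^]\<^bsub>A\<^esub> k) = \<one>"
      using pi.hom_nat_pow[OF e(1)[OF a(2)], of k] e(2)[OF a(2)] by simp
    then show ?thesis
      unfolding Z_def kernel_def using e(1)[OF a(2)] by simp
  qed

  \<comment> \<open>The central subgroup \<open>N\<close> and the quotient \<open>Q\<close>\<close>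
  have "(\<lambda>(a, k). e a [^]\<^bsub>A\<^esub> k) ` P \<subseteq> carrier (A\<lparr>carrier := Z\<rparr>)"
    using pow by auto
  then obtain \<psi> where \<psi>: "\<psi> \<in> hom (free_Abelian_group P) (A\<lparr>carrier := Z\<rparr>)"
    "\<And>p. p \<in> P \<Longrightarrow> \<psi> (frag_of p) = (case p of (a, k) \<Rightarrow> e a [^]\<^bsub>A\<^esub> k)"
    by (rule ZC.free_Abelian_group_universal) blast
  interpret \<psi>: group_hom "free_Abelian_group P" A \<psi>
    using hom_A[OF \<psi>(1)] by (simp add: group_hom_def group_hom_axioms_def A.is_group)
  define N where "N = \<psi> ` carrier (free_Abelian_group P)"
  have NZ: "N \<subseteq> Z" using \<psi>(1) by (auto simp: N_def hom_def)
  have "subgroup N A" unfolding N_def by (rule \<psi>.img_is_subgroup)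
  then have "N \<lhd> A"
  proof (rule A.normalI, intro ballI)
    fix x assume "x \<in> carrier A"
    then show "N #>\<^bsub>A\<^esub> x = x <#\<^bsub>A\<^esub> N"
      using central NZ by (auto simp: r_coset_def l_coset_def subset_iff)
  qed
  then interpret N: normal N A .
  define q where "q = (\<lambda>x. N #>\<^bsub>A\<^esub> x)"
  define Q where "Q = A Mod N"
  interpret Q: group Q unfolding Q_def by (rule N.factorgroup_is_group)
  interpret q: group_hom A Q q
    using N.r_coset_hom_Mod A.is_group Q.is_group
    by (simp add: group_hom_def group_hom_axioms_def q_def Q_def)
  have q_one: "q x = \<one>\<^bsub>Q\<^esub> \<longleftrightarrow> x \<in> N" if "x \<in> carrier A" for x
    using that A.coset_join1[of N x] A.coset_join2[of x N] N.subgroup_axioms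
    by (auto simp: q_def Q_def FactGroup_def)
  have e_\<Gamma>: "e ` \<Gamma> \<subseteq> carrier A" "(\<lambda>a. q (e a)) ` \<Gamma> \<subseteq> carrier Q"
    using e assms(1) by (auto intro!: q.hom_closed)
  \<comment> \<open>The elements \<open>q (e a)\<close> satisfy the relations of the presentation of
    \<open>G\<close>: conjugation relations already hold in \<open>A\<close> as instances of its
    defining relations, and power relations hold because \<open>N\<close> is factored out.\<close>
  have relQ: "word_eval Q (\<lambda>a. q (e a)) r = word_eval Q (\<lambda>a. q (e a)) s"
    if rs: "(r, s) \<in> C_bar_rels C P" for r s
  proof -
    from rs consider a b c where "(a, b, c) \<in> C" "r = [(b, False), (a, True), (b, True)]" "s = [(c, True)]"
      | a k where "(a, k) \<in> P" "r = replicate k (a, True)" "s = []"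
      by (auto simp: C_bar_rels_def)
    then show ?thesis
    proof cases
      case 1
      have abc: "a \<in> \<Gamma>" "b \<in> \<Gamma>" "c \<in> \<Gamma>" using 1 CP by auto
      then have abc': "a \<in> carrier G" "b \<in> carrier G" "c \<in> carrier G" using assms(1) by auto
      have "ev r = ev s" using rs 1 abc by (intro rel) auto
      then have "inv b \<otimes> a \<otimes> b = c" using 1 abc' by (simp add: ev_def m_assoc)
      then have "e a \<otimes>\<^bsub>A\<^esub> e b = e b \<otimes>\<^bsub>A\<^esub> e c"
        using A_gen_commute[of a b] abc' by (simp add: e_def A_def)
      then have "inv\<^bsub>A\<^esub> e b \<otimes>\<^bsub>A\<^esub> (e a \<otimes>\<^bsub>A\<^esub> e b) = e c"
        using abc' e by (simp add: A.inv_solve_left')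
      then have "q (inv\<^bsub>A\<^esub> e b \<otimes>\<^bsub>A\<^esub> (e a \<otimes>\<^bsub>A\<^esub> e b)) = q (e c)"
        by simp
      then show ?thesis using 1 abc' e by simp
    next
      case 2
      have a: "a \<in> carrier G" using 2 CP assms(1) by auto
      have "e a [^]\<^bsub>A\<^esub> k \<in> N"
        unfolding N_def using 2 \<psi>(2)[of "(a, k)"] by (intro image_eqI[of _ _ "frag_of (a, k)"]) auto
      then have "q (e a) [^]\<^bsub>Q\<^esub> k = \<one>\<^bsub>Q\<^esub>"
        using q_one[of "e a [^]\<^bsub>A\<^esub> k"] a e by (simp add: q.hom_nat_pow)
      then show ?thesis using 2 a e by (simp add: Q.word_eval_replicate)
    qed
  qed

  \<comment> \<open>The splitting of \<pi> modulo \<open>N\<close>\<close>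
  define wd where "wd = (\<lambda>g. SOME w. w \<in> words \<Gamma> \<and> ev w = g)"
  have wd: "wd g \<in> words \<Gamma>" "ev (wd g) = g" if "g \<in> carrier G" for g
  proof -
    have "\<exists>w. w \<in> words \<Gamma> \<and> ev w = g" using that D(3) by auto
    then have "wd g \<in> words \<Gamma> \<and> ev (wd g) = g" unfolding wd_def by (rule someI_ex)
    then show "wd g \<in> words \<Gamma>" "ev (wd g) = g" by auto
  qed
  \<comment> \<open>This is only a set-theoretic section of \<pi>, dependent on the chosen words; it
    becomes a homomorphism after composition with \<open>q\<close>.\<close>
  define \<sigma> where "\<sigma> = (\<lambda>g. word_eval A e (wd g))"
  have \<sigma>: "\<sigma> g \<in> carrier A" "A_pi G (\<sigma> g) = g" if "g \<in> carrier G" for g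
  proof -
    show "\<sigma> g \<in> carrier A"
      unfolding \<sigma>_def using e_\<Gamma>(1) wd(1)[OF that] by (rule A.word_eval_closed)
    have "word_eval G (\<lambda>x. A_pi G (e x)) w = ev w" if "w \<in> words \<Gamma>" for w
      using that assms(1) e(2) by (induction w) (auto simp: ev_def subset_iff)
    then show "A_pi G (\<sigma> g) = g"
      unfolding \<sigma>_def using pi.word_eval_hom[OF e_\<Gamma>(1)] wd[OF that] by simp
  qed
  \<comment> \<open>Two words with the same value in \<open>G\<close> are equivalent under the
    presentation, so by \<open>relQ\<close> they agree in \<open>Q\<close>. Hence the choice of
    \<open>wd\<close> is invisible modulo \<open>N\<close>.\<close>
  have q\<sigma>: "q (\<sigma> (ev w)) = word_eval Q (\<lambda>a. q (e a)) w" if w: "w \<in> words \<Gamma>" for w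
  proof -
    have g: "ev w \<in> carrier G" using D(3) w by auto
    have "pres_eq \<Gamma> (C_bar_rels C P) (wd (ev w)) w"
      using D(2)[OF wd(1)[OF g] w] wd(2)[OF g] by simp
    then have "word_eval Q (\<lambda>a. q (e a)) (wd (ev w)) = word_eval Q (\<lambda>a. q (e a)) w"
      using Q.word_eval_pres_eq[OF e_\<Gamma>(2), of "C_bar_rels C P"] relQ by blast
    then show ?thesis
      using q.word_eval_hom[OF e_\<Gamma>(1) wd(1)[OF g]] by (simp add: \<sigma>_def)
  qed
  have q\<sigma>_hom: "(\<lambda>g. q (\<sigma> g)) \<in> hom G Q"
  proof (rule homI)
    fix g h assume gh: "g \<in> carrier G" "h \<in> carrier G"
    then obtain u v where uv: "u \<in> words \<Gamma>" "v \<in> words \<Gamma>" "g = ev u" "h = ev v"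
      using D(3) by auto
    have "g \<otimes> h = ev (u @ v)"
      using uv assms(1) by (simp add: ev_def word_eval_append[of _ \<Gamma>])
    then show "q (\<sigma> (g \<otimes> h)) = q (\<sigma> g) \<otimes>\<^bsub>Q\<^esub> q (\<sigma> h)"
      using uv by (simp add: q\<sigma> Q.word_eval_append[OF e_\<Gamma>(2)])
  qed (simp add: \<sigma>)
  interpret s: group_hom G Q "\<lambda>g. q (\<sigma> g)"
    using q\<sigma>_hom by (simp add: group_hom_def group_hom_axioms_def is_group Q.is_group)

  \<comment> \<open>The central defect between the generators \<open>e a\<close> and the
    section\<close>
  define t where "t = (\<lambda>a. e a \<otimes>\<^bsub>A\<^esub> inv\<^bsub>A\<^esub> \<sigma> a)"
  have t: "t a \<in> Z" if "a \<in> carrier G" for a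
    unfolding t_def Z_def kernel_def using that e \<sigma> by simp
  \<comment> \<open>Move \<open>e a\<close> past \<open>\<sigma> b\<close> by
    \<open>A_gen_conj\<close>, write each generator in \<open>Q\<close> as its defect times its
    section value, and cancel the section values, using that defects are central and that
    \<open>q\<close> after \<sigma> is multiplicative.\<close>
  have t_conj: "q (t (inv b \<otimes> a \<otimes> b)) = q (t a)" if ab: "a \<in> carrier G" "b \<in> carrier G" for a b
  proof -
    let ?c = "inv b \<otimes> a \<otimes> b"
    have c: "?c \<in> carrier G" using ab by simp
    have "e a \<otimes>\<^bsub>A\<^esub> \<sigma> b = \<sigma> b \<otimes>\<^bsub>A\<^esub> e ?c"
      using A_gen_conj[of "\<sigma> b" a] \<sigma>[of b] ab by (simp add: e_def A_def)
    then have "q (e a) \<otimes>\<^bsub>Q\<^esub> q (\<sigma> b) = q (\<sigma> b) \<otimes>\<^bsub>Q\<^esub> q (e ?c)"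
      using ab c e \<sigma> by (metis q.hom_mult)
    moreover have "q (e x) = q (t x) \<otimes>\<^bsub>Q\<^esub> q (\<sigma> x)" if "x \<in> carrier G" for x
      using that e \<sigma> by (simp add: t_def Q.m_assoc)
    moreover have "q (\<sigma> b) \<otimes>\<^bsub>Q\<^esub> q (\<sigma> ?c) = q (\<sigma> a) \<otimes>\<^bsub>Q\<^esub> q (\<sigma> b)"
    proof -
      have "b \<otimes> ?c = a \<otimes> b" using ab by (simp add: m_assoc[symmetric])
      then show ?thesis using s.hom_mult[of b ?c] s.hom_mult[of a b] ab c by simp
    qed
    moreover have "q (\<sigma> b) \<otimes>\<^bsub>Q\<^esub> q (t ?c) = q (t ?c) \<otimes>\<^bsub>Q\<^esub> q (\<sigma> b)"
      using central[OF t[OF c] \<sigma>(1)[OF ab(2)]] t[OF c] \<sigma>(1)[OF ab(2)]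
      by (metis Z.mem_carrier q.hom_mult)
    moreover have "q (t x) \<in> carrier Q" if "x \<in> carrier G" for x
      using t[OF that] by (intro q.hom_closed Z.mem_carrier)
    moreover have "q (\<sigma> x) \<in> carrier Q" if "x \<in> carrier G" for x
      using that by (rule s.hom_closed)
    ultimately have "q (t a) \<otimes>\<^bsub>Q\<^esub> (q (\<sigma> a) \<otimes>\<^bsub>Q\<^esub> q (\<sigma> b))
        = q (t ?c) \<otimes>\<^bsub>Q\<^esub> (q (\<sigma> a) \<otimes>\<^bsub>Q\<^esub> q (\<sigma> b))"
      using ab c by (metis Q.m_assoc)
    then show ?thesis
      using ab c t \<sigma> by simp
  qed

  \<comment> \<open>Expressing the quotient map through \<pi> and \<open>A_Ab\<close>\<close>
  define rep where "rep = (\<lambda>c. SOME a. a \<in> carrier G \<and> conj_class G a = c)"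
  have rep: "rep c \<in> carrier G" "conj_class G (rep c) = c" if "c \<in> conj_classes G" for c
  proof -
    have "\<exists>a. a \<in> carrier G \<and> conj_class G a = c" using that by (auto simp: conj_classes_def)
    then have "rep c \<in> carrier G \<and> conj_class G (rep c) = c" unfolding rep_def by (rule someI_ex)
    then show "rep c \<in> carrier G" "conj_class G (rep c) = c" by auto
  qed
  \<comment> \<open>The defect is shown to be a class function only modulo \<open>N\<close>. Hence
    \<Psi> below is defined on classes by representatives, and the choice disappears under
    \<open>q\<close>.\<close>
  have t_rep: "q (t (rep (conj_class G a))) = q (t a)" if a: "a \<in> carrier G" for a
  proof -
    let ?c = "conj_class G a"
    have c: "?c \<in> conj_classes G" using a by (simp add: conj_classes_def)
    have "a \<in> conj_class G a"
      using a by (auto simp: conj_class_def intro!: exI[of _ \<one>])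
    then have "a \<in> conj_class G (rep ?c)" using rep(2)[OF c] by simp
    then obtain b where "b \<in> carrier G" "a = inv b \<otimes> rep ?c \<otimes> b" by (auto simp: conj_class_def)
    then show ?thesis using t_conj[OF rep(1)[OF c]] by metis
  qed
  have "(\<lambda>c. t (rep c)) ` conj_classes G \<subseteq> carrier (A\<lparr>carrier := Z\<rparr>)"
    using t rep by auto
  then obtain \<Psi> where \<Psi>: "\<Psi> \<in> hom F (A\<lparr>carrier := Z\<rparr>)"
    "\<And>c. c \<in> conj_classes G \<Longrightarrow> \<Psi> (frag_of c) = t (rep c)"
    unfolding F_def by (rule ZC.free_Abelian_group_universal) blast
  have \<Psi>Z: "\<Psi> c \<in> Z" if "c \<in> carrier F" for c using that \<Psi>(1) by (auto simp: hom_def)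

  \<comment> \<open>The candidate formula for \<open>q\<close>: it depends on \<open>x\<close> only
    through its images under \<open>A_Ab\<close> and \<pi>.\<close>
  define \<Phi> where "\<Phi> = (\<lambda>x. q (\<Psi> (A_Ab G x)) \<otimes>\<^bsub>Q\<^esub> q (\<sigma> (A_pi G x)))"
  have "\<Phi> \<in> hom A Q"
  proof (rule homI)
    fix x y assume x: "x \<in> carrier A" and y: "y \<in> carrier A"
    let ?zx = "\<Psi> (A_Ab G x)" and ?zy = "\<Psi> (A_Ab G y)"
      and ?sx = "\<sigma> (A_pi G x)" and ?sy = "\<sigma> (A_pi G y)"
    have z: "?zx \<in> Z" "?zy \<in> Z" using x y by (auto intro!: \<Psi>Z Ab.hom_closed)
    note zA = z[THEN Z.mem_carrier]
    have sA: "?sx \<in> carrier A" "?sy \<in> carrier A" using x y \<sigma> by auto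
    have "\<Psi> (A_Ab G (x \<otimes>\<^bsub>A\<^esub> y)) = ?zx \<otimes>\<^bsub>A\<^esub> ?zy"
      using x y \<Psi>(1) Ab.hom_closed[OF x] Ab.hom_closed[OF y] Ab.hom_mult[OF x y]
      by (auto simp: hom_def)
    then have "\<Phi> (x \<otimes>\<^bsub>A\<^esub> y) = q ?zx \<otimes>\<^bsub>Q\<^esub> q ?zy \<otimes>\<^bsub>Q\<^esub> (q ?sx \<otimes>\<^bsub>Q\<^esub> q ?sy)"
      using x y zA by (simp add: \<Phi>_def)
    also have "\<dots> = q ?zx \<otimes>\<^bsub>Q\<^esub> q (?zy \<otimes>\<^bsub>A\<^esub> ?sx) \<otimes>\<^bsub>Q\<^esub> q ?sy"
      using zA sA by (simp add: Q.m_assoc)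
    \<comment> \<open>Multiplicativity rests on this exchange: \<open>?zy\<close> is central and so
      moves past \<open>?sx\<close>.\<close>
    also have "\<dots> = \<Phi> x \<otimes>\<^bsub>Q\<^esub> \<Phi> y"
      unfolding central[OF z(2) sA(1)] \<Phi>_def using zA sA by (simp add: Q.m_assoc)
    finally show "\<Phi> (x \<otimes>\<^bsub>A\<^esub> y) = \<Phi> x \<otimes>\<^bsub>Q\<^esub> \<Phi> y" .
  next
    fix x assume x: "x \<in> carrier A"
    then show "\<Phi> x \<in> carrier Q"
      unfolding \<Phi>_def using \<Psi>Z[OF Ab.hom_closed[OF x]] \<sigma>[of "A_pi G x"]
      by (intro Q.m_closed q.hom_closed) auto
  qed
  moreover have "q (e a) = \<Phi> (e a)" if a: "a \<in> carrier G" for a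
  proof -
    have "conj_class G a \<in> conj_classes G" using a by (simp add: conj_classes_def)
    then have "\<Phi> (e a) = q (t a) \<otimes>\<^bsub>Q\<^esub> q (\<sigma> a)"
      using a e \<Psi>(2) t_rep by (simp add: \<Phi>_def)
    also have "\<dots> = q (e a)" using a e \<sigma> by (simp add: t_def Q.m_assoc)
    finally show ?thesis by simp
  qed
  ultimately have q\<Phi>: "q x = \<Phi> x" if "x \<in> carrier A" for x
    using presented_group_hom_eq[of Q q "carrier G" "A_rels G" \<Phi> x] that
      Q.is_group q.homh by (simp add: A_def A_group_def e_def A_gen_def)

  \<comment> \<open>The common kernel lies in \<open>N\<close>, where \<open>A_Ab\<close> is
    injective\<close>
  show ?thesis
  proof
    fix x assume "x \<in> kernel (A_group G) G (A_pi G) \<inter>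
      kernel (A_group G) (free_Abelian_group (conj_classes G)) (A_Ab G)"
    then have x: "x \<in> carrier A" "A_pi G x = \<one>" "A_Ab G x = \<one>\<^bsub>F\<^esub>"
      by (auto simp: kernel_def A_def F_def)
    have "\<Psi> \<one>\<^bsub>F\<^esub> = \<one>\<^bsub>A\<^esub>"
      using hom_one[OF \<Psi>(1)] ZC.is_group by (simp add: F_def)
    \<comment> \<open>The section value \<open>\<sigma> \<one>\<close> need not be trivial in
      \<open>A\<close>, but its image in \<open>Q\<close> is, because \<open>q\<close> after
      \<sigma> is a homomorphism.\<close>
    then have "q x = \<one>\<^bsub>Q\<^esub>"
      using q\<Phi>[OF x(1)] x s.hom_one q.hom_one by (simp add: \<Phi>_def)
    then obtain y where y: "Poly_Mapping.keys y \<subseteq> P" "x = \<psi> y"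
      using q_one[OF x(1)] by (auto simp: N_def)
    have "Poly_Mapping.lookup y (a, k) = 0" if ak: "(a, k) \<in> P" for a k
    proof -
      have "Poly_Mapping.lookup (A_Ab G (\<psi> y)) (conj_class G a) = int k * Poly_Mapping.lookup y (a, k)"
      proof (rule A_Ab_lookup_power_product[OF _ inj _ _ ak y(1)])
        show "P \<subseteq> carrier G \<times> UNIV" using CP assms(1) by auto
        show "\<psi> \<in> hom (free_Abelian_group P) (A_group G)"
          using hom_A[OF \<psi>(1)] by (simp add: A_def)
        show "\<psi> (frag_of (a, k)) = A_gen G a [^]\<^bsub>A_group G\<^esub> k" if "(a, k) \<in> P" for a k
          using \<psi>(2)[OF that] by (simp add: A_def e_def)
      qed
      \<comment> \<open>The left side is zero since \<open>A_Ab\<close> kills \<open>x\<close>, and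
        \<open>k\<close> is at least 2, so the factor \<open>int k\<close> can be cancelled.\<close>
      then show ?thesis using x y(2) ak CP by (auto simp: F_def)
    qed
    then have "y = 0"
      using y(1) by (metis in_keys_iff poly_mapping_eqI lookup_zero subsetD surj_pair)
    then show "x \<in> {\<one>\<^bsub>A_group G\<^esub>}" using y(2) \<psi>.hom_one by (simp add: A_def)
  qed
qed

end

text \<open>Torsion elements need not form a subgroup, so the isomorphism is stated for the
  inherited partial multiplications, onto the torsion part of a subgroup \<open>H\<close>; the proof
  takes for \<open>H\<close> the image under \<pi> of the kernel of \<open>A_Ab\<close>. The last
  conjunct gives an ordinary group isomorphism whenever the torsion of the structure group is a
  subgroup.\<close>

theorem corollary2p8:
  fixes G :: "('a, 'm) monoid_scheme"
  assumes "C_bar_group G"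
  shows "Tor (A_group G) =
           kernel (A_group G) (free_Abelian_group (conj_classes G)) (A_Ab G) \<inter> A_pi G -` Tor G
    \<and> (\<exists>H f. subgroup H G \<and> partial_iso f (A_group G) (Tor (A_group G)) G (H \<inter> Tor G))
    \<and> (subgroup (Tor (A_group G)) (A_group G) \<longrightarrow>
        (\<exists>K. subgroup K G \<and> K \<subseteq> Tor G \<and>
          (A_group G)\<lparr>carrier := Tor (A_group G)\<rparr> \<cong> G\<lparr>carrier := K\<rparr>))"
proof -
  interpret group G using assms by (simp add: C_bar_group_def)
  define A where "A = A_group G"
  define KA where "KA = kernel A (free_Abelian_group (conj_classes G)) (A_Ab G)"
  interpret pi: group_hom A G "A_pi G" unfolding A_def by (rule A_pi_group_hom)
  interpret Ab: group_hom A "free_Abelian_group (conj_classes G)" "A_Ab G"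
    unfolding A_def by (rule A_Ab_group_hom)
  interpret KA: subgroup KA A unfolding KA_def by (rule Ab.subgroup_kernel)
  obtain \<Gamma> C P where "\<Gamma> \<subseteq> carrier G" "C_bar_presentation \<Gamma> C P (\<lambda>a. a) G"
    using assms by (auto simp: C_bar_group_def)
  then have triv: "kernel A G (A_pi G) \<inter> KA \<subseteq> {\<one>\<^bsub>A\<^esub>}"
    unfolding A_def KA_def by (rule kernel_A_pi_Int_kernel_A_Ab)
  then have Tor: "Tor A = KA \<inter> A_pi G -` Tor G"
    unfolding A_def KA_def by (rule Tor_A_group)
  have "inj_on (A_pi G) KA"
  proof (rule inj_onI)
    fix x y assume xy: "x \<in> KA" "y \<in> KA" "A_pi G x = A_pi G y"
    \<comment> \<open>The quotient of two elements of \<open>KA\<close> with equal images lies in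
      both kernels.\<close>
    then have "x \<otimes>\<^bsub>A\<^esub> inv\<^bsub>A\<^esub> y \<in> kernel A G (A_pi G) \<inter> KA"
      by (auto simp: kernel_def)
    then have "x \<otimes>\<^bsub>A\<^esub> inv\<^bsub>A\<^esub> y = \<one>\<^bsub>A\<^esub>" using triv by blast
    then show "x = y" using xy by (metis KA.mem_carrier pi.G.inv_closed pi.G.inv_equality pi.G.inv_inv)
  qed
  then have "bij_betw (A_pi G) (Tor A) (A_pi G ` KA \<inter> Tor G)"
    unfolding bij_betw_def Tor by (auto intro: inj_on_subset)
  \<comment> \<open>Products of elements of \<open>KA\<close> stay in \<open>KA\<close>, and their
    images stay in its image. So on both sides membership of a product in the torsion part reduces
    to its image lying in \<open>Tor G\<close>.\<close>
  moreover have "A_pi G (x \<otimes>\<^bsub>A\<^esub> y) = A_pi G x \<otimes>\<^bsub>G\<^esub> A_pi G y \<and>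
      A_pi G x \<otimes>\<^bsub>G\<^esub> A_pi G y \<in> A_pi G ` KA"
    if "x \<in> KA" "y \<in> KA" for x y
    using that by (metis KA.m_closed KA.mem_carrier imageI pi.hom_mult)
  ultimately have iso: "partial_iso (A_pi G) A (Tor A) G (A_pi G ` KA \<inter> Tor G)"
    unfolding partial_iso_def by (simp add: Tor)
  have H: "subgroup (A_pi G ` KA) G" by (rule pi.subgroup_img_is_subgroup[OF KA.subgroup_axioms])
  have "\<exists>K. subgroup K G \<and> K \<subseteq> Tor G \<and> A\<lparr>carrier := Tor A\<rparr> \<cong> G\<lparr>carrier := K\<rparr>"
    if sub: "subgroup (Tor A) A"
  proof (intro exI conjI)
    \<comment> \<open>The target is the image of the subgroup \<open>Tor A\<close>, hence itself a
      subgroup; then \<open>partial_iso\<close> becomes ordinary isomorphism.\<close>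
    have img: "A_pi G ` Tor A = A_pi G ` KA \<inter> Tor G" by (auto simp: Tor)
    show K: "subgroup (A_pi G ` KA \<inter> Tor G) G"
      using pi.subgroup_img_is_subgroup[OF sub] by (simp add: img)
    show "A\<lparr>carrier := Tor A\<rparr> \<cong> G\<lparr>carrier := A_pi G ` KA \<inter> Tor G\<rparr>"
      using iso partial_iso_iff_iso[OF sub K] by (auto simp: is_iso_def)
  qed auto
  then show ?thesis using Tor H iso unfolding A_def KA_def by blast
qed

end
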